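(* Let $W_\omega=\mathrm{shift}(\omega_0,\omega_1,\dots)$ be a unilateral weighted shift with bounded positive weights, and let $\Theta(W_\omega)$ be the associated $2$-variable weighted shift on $\ell^2(\mathbb{Z}_+^2)$, with weights $\alpha_{(k_1,k_2)}=\beta_{(k_1,k_2)}:=\omega_{k_1+k_2}$ for $k_1,k_2\ge0$. If $\Theta(W_\omega)$ is (jointly) hyponormal, then its toral Aluthge transform $\widetilde\Theta(W_\omega)$ and its spherical Aluthge transform $\widehat\Theta(W_\omega)$ are both (jointly) hyponormal.
   Context: $\mathbb{Z}_+=\{0,1,2,\dots\}$, $\varepsilon_1=(1,0)$, $\varepsilon_2=(0,1)$, and $\{e_{\mathbf k}\}$ is the canonical orthonormal basis of $\ell^2(\mathbb{Z}_+^2)$. The $2$-variable weighted shift with bounded positive weights $\alpha_{\mathbf k},\beta_{\mathbf k}$ is the pair $(T_1,T_2)$ with $T_1e_{\mathbf k}=\alpha_{\mathbf k}e_{\mathbf k+\varepsilon_1}$ and $T_2e_{\mathbf k}=\beta_{\mathbf k}e_{\mathbf k+\varepsilon_2}$; for $\Theta(W_\omega)$ this pair is automatically commuting. Toral Aluthge transform of $(T_1,T_2)$: with polar decompositions $T_i=V_i|T_i|$ ($V_i$ a partial isometry, $|T_i|=\sqrt{T_i^*T_i}$, $\ker V_i=\ker T_i$), it is $(|T_1|^{1/2}V_1|T_1|^{1/2},|T_2|^{1/2}V_2|T_2|^{1/2})$. Spherical Aluthge transform of $(T_1,T_2)$: let $P:=\sqrt{T_1^*T_1+T_2^*T_2}$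 and $(T_1,T_2)=(U_1P,U_2P)$ with $\ker U_1\cap\ker U_2=\ker P$; it is $(\sqrt P\,U_1\sqrt P,\sqrt P\,U_2\sqrt P)$. A pair $(S_1,S_2)$ of bounded operators on $\mathcal H$ is (jointly) hyponormal if the $2\times2$ operator matrix $\begin{pmatrix}[S_1^*,S_1]&[S_2^*,S_1]\\ [S_1^*,S_2]&[S_2^*,S_2]\end{pmatrix}$ is positive semidefinite on $\mathcal H\oplus\mathcal H$, where $[A,B]=AB-BA$. *)

theory Defs
  imports "HOL-Analysis.Analysis"
begin

section \<open>The complex Hilbert space of square-summable families\<close>

typedef 'i ell2 = "{f :: 'i \<Rightarrow> complex. (\<lambda>i. (cmod (f i))\<^sup>2) summable_on UNIV}"
  morphisms ell2_coord Abs_ell2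
  by (rule exI[of _ "\<lambda>_. 0"]) simp

setup_lifting type_definition_ell2

lemma ell2_add_closed:
  fixes f g :: "'i \<Rightarrow> complex"
  assumes "(\<lambda>i. (cmod (f i))\<^sup>2) summable_on UNIV" "(\<lambda>i. (cmod (g i))\<^sup>2) summable_on UNIV"
  shows "(\<lambda>i. (cmod (f i + g i))\<^sup>2) summable_on UNIV"
proof (rule summable_on_comparison_test)
  show "(\<lambda>i. 2 * (cmod (f i))\<^sup>2 + 2 * (cmod (g i))\<^sup>2) summable_on UNIV"
    by (intro summable_on_add summable_on_cmult_right assms)
  fix i
  have "(cmod (f i + g i))\<^sup>2 \<le> (cmod (f i) + cmod (g i))\<^sup>2"
    by (intro power_mono norm_triangle_ineq) auto
  also have "\<dots> \<le> 2 * (cmod (f i))\<^sup>2 + 2 * (cmod (g i))\<^sup>2"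
    using sum_squares_bound[of "cmod (f i)" "cmod (g i)"]
    by (simp add: power2_sum)
  finally show "(cmod (f i + g i))\<^sup>2 \<le> 2 * (cmod (f i))\<^sup>2 + 2 * (cmod (g i))\<^sup>2" .
qed auto

lemma ell2_scale_closed:
  fixes f :: "'i \<Rightarrow> complex"
  assumes "(\<lambda>i. (cmod (f i))\<^sup>2) summable_on UNIV"
  shows "(\<lambda>i. (cmod (c * f i))\<^sup>2) summable_on UNIV"
  by (simp add: norm_mult power_mult_distrib summable_on_cmult_right assms)

lemma ell2_mult_summable:
  fixes f g :: "'i \<Rightarrow> complex"
  assumes "(\<lambda>i. (cmod (f i))\<^sup>2) summable_on UNIV" "(\<lambda>i. (cmod (g i))\<^sup>2) summable_on UNIV"
  shows "(\<lambda>i. f i * cnj (g i)) summable_on UNIV"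
proof (rule abs_summable_summable, rule summable_on_comparison_test)
  show "(\<lambda>i. (cmod (f i))\<^sup>2 + (cmod (g i))\<^sup>2) summable_on UNIV"
    by (intro summable_on_add assms)
  fix i
  show "cmod (f i * cnj (g i)) \<le> (cmod (f i))\<^sup>2 + (cmod (g i))\<^sup>2"
    using sum_squares_bound[of "cmod (f i)" "cmod (g i)"]
      mult_nonneg_nonneg[OF norm_ge_zero[of "f i"] norm_ge_zero[of "g i"]]
    unfolding norm_mult complex_mod_cnj by linarith
qed auto

instantiation ell2 :: (type) real_vector
begin

lift_definition zero_ell2 :: "'a ell2" is "\<lambda>_. 0" by simp

lift_definition plus_ell2 :: "'a ell2 \<Rightarrow> 'a ell2 \<Rightarrow> 'a ell2" is "\<lambda>f g i. f i + g i"
  by (rule ell2_add_closed)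

lift_definition uminus_ell2 :: "'a ell2 \<Rightarrow> 'a ell2" is "\<lambda>f i. - f i" by simp

lift_definition minus_ell2 :: "'a ell2 \<Rightarrow> 'a ell2 \<Rightarrow> 'a ell2" is "\<lambda>f g i. f i - g i"
  subgoal for f g using ell2_add_closed[of f "\<lambda>i. - g i"] by simp
  done

lift_definition scaleR_ell2 :: "real \<Rightarrow> 'a ell2 \<Rightarrow> 'a ell2" is "\<lambda>r f i. complex_of_real r * f i"
  by (rule ell2_scale_closed)

instance
  by standard (transfer; simp add: fun_eq_iff algebra_simps)+

end

lift_definition scaleC :: "complex \<Rightarrow> 'i ell2 \<Rightarrow> 'i ell2"  (infixr \<open>*\<^sub>C\<close> 75)
  is "\<lambda>c f i. c * f i"
  by (rule ell2_scale_closed)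

text \<open>The inner product is linear in its first argument.\<close>

definition cinner :: "'i ell2 \<Rightarrow> 'i ell2 \<Rightarrow> complex" where
  "cinner x y = (\<Sum>\<^sub>\<infinity>i. ell2_coord x i * cnj (ell2_coord y i))"

lemma cinner_summable: "(\<lambda>i. ell2_coord x i * cnj (ell2_coord y i)) summable_on UNIV"
  using ell2_coord[of x] ell2_coord[of y] by (auto intro: ell2_mult_summable)

lemma cinner_add_left: "cinner (x + y) z = cinner x z + cinner y z"
  by (simp add: cinner_def plus_ell2.rep_eq distrib_right infsum_add cinner_summable)

lemma cinner_scaleC_left: "cinner (c *\<^sub>C x) y = c * cinner x y"
  by (simp add: cinner_def scaleC.rep_eq mult.assoc infsum_cmult_right cinner_summable)

lemma cinner_scaleR_left: "cinner (r *\<^sub>R x) y = r * cinner x y"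
  by (simp add: cinner_def scaleR_ell2.rep_eq mult.assoc infsum_cmult_right cinner_summable)

lemma cinner_commute: "cinner x y = cnj (cinner y x)"
  unfolding cinner_def infsum_cnj[symmetric] by (simp add: mult.commute)

lemma Re_cinner_same: "Re (cinner x x) = (\<Sum>\<^sub>\<infinity>i. (cmod (ell2_coord x i))\<^sup>2)"
  unfolding cinner_def infsum_Re[OF cinner_summable, symmetric]
  by (simp add: complex_mult_cnj cmod_power2)

text \<open>The real inner product \<^term>\<open>Re (cinner x y)\<close> induces the usual norm of $\ell^2$.\<close>

instantiation ell2 :: (type) real_inner
begin

definition inner_ell2 :: "'a ell2 \<Rightarrow> 'a ell2 \<Rightarrow> real" where
  "inner_ell2 x y = Re (cinner x y)"

definition norm_ell2 :: "'a ell2 \<Rightarrow> real" where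
  "norm_ell2 x = sqrt (\<Sum>\<^sub>\<infinity>i. (cmod (ell2_coord x i))\<^sup>2)"

definition sgn_ell2 :: "'a ell2 \<Rightarrow> 'a ell2" where
  "sgn_ell2 x = x /\<^sub>R norm x"

definition dist_ell2 :: "'a ell2 \<Rightarrow> 'a ell2 \<Rightarrow> real" where
  "dist_ell2 x y = norm (x - y)"

definition uniformity_ell2 :: "('a ell2 \<times> 'a ell2) filter" where
  "uniformity_ell2 = (INF e\<in>{0<..}. principal {(x, y). dist x y < e})"

definition open_ell2 :: "'a ell2 set \<Rightarrow> bool" where
  "open_ell2 U = (\<forall>x\<in>U. eventually (\<lambda>(x', y). x' = x \<longrightarrow> y \<in> U) uniformity)"

instance
proof
  fix x y z :: "'a ell2" and r :: real
  show "x \<bullet> y = y \<bullet> x"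
    unfolding inner_ell2_def by (subst cinner_commute) simp
  show "(x + y) \<bullet> z = x \<bullet> z + y \<bullet> z"
    by (simp add: inner_ell2_def cinner_add_left)
  show "(r *\<^sub>R x) \<bullet> y = r * (x \<bullet> y)"
    by (simp add: inner_ell2_def cinner_scaleR_left)
  show "0 \<le> x \<bullet> x"
    by (simp add: inner_ell2_def Re_cinner_same infsum_nonneg)
  show "x \<bullet> x = 0 \<longleftrightarrow> x = 0"
  proof
    assume "x \<bullet> x = 0"
    then have "ell2_coord x i = 0" for i
      using nonneg_infsum_le_0D[of "\<lambda>i. (cmod (ell2_coord x i))\<^sup>2" UNIV i] ell2_coord[of x]
      by (simp add: inner_ell2_def Re_cinner_same)
    then show "x = 0"
      by (simp add: ell2_coord_inject[symmetric] zero_ell2.rep_eq fun_eq_iff)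
  qed (simp add: inner_ell2_def cinner_def zero_ell2.rep_eq)
  show "norm x = sqrt (x \<bullet> x)"
    by (simp add: norm_ell2_def inner_ell2_def Re_cinner_same)
qed (simp_all add: sgn_ell2_def dist_ell2_def uniformity_ell2_def open_ell2_def)

end

lift_definition ket :: "'i \<Rightarrow> 'i ell2" is "\<lambda>k i. if i = k then 1 else 0"
proof -
  fix k :: 'i
  have "(\<lambda>i. (cmod (if i = k then 1 else 0))\<^sup>2) summable_on {k}" by simp
  then show "(\<lambda>i. (cmod (if i = k then 1 else 0))\<^sup>2) summable_on UNIV"
    by (rule summable_on_cong_neutral[THEN iffD1, rotated -1]) auto
qed


section \<open>Bounded operators\<close>

type_synonym 'i op = "'i ell2 \<Rightarrow> 'i ell2"

definition bounded_clinear :: "'i op \<Rightarrow> bool" where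
  "bounded_clinear T \<longleftrightarrow> bounded_linear T \<and> (\<forall>c x. T (c *\<^sub>C x) = c *\<^sub>C T x)"

lemma shift_exists:
  fixes s :: "'i \<Rightarrow> 'i" and w :: "'i \<Rightarrow> real"
  assumes s: "inj s" and w: "bounded (range w)"
  shows "\<exists>T. bounded_clinear T \<and> (\<forall>k. T (ket k) = complex_of_real (w k) *\<^sub>C ket (s k))"
proof -
  obtain B where B: "\<And>k. \<bar>w k\<bar> \<le> B" using w by (auto simp: bounded_iff)
  have B0: "0 \<le> B" using B[of undefined] by linarith
  define h where "h f i = (if i \<in> range s then w (inv s i) * f (inv s i) else 0)" for f :: "'i \<Rightarrow> complex" and i
  have hs: "h f (s k) = complex_of_real (w k) * f k" for f k by (simp add: h_def s)
  have aux: "(\<lambda>i. (cmod (h f i))\<^sup>2) summable_on UNIV \<and>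
     (\<Sum>\<^sub>\<infinity>i. (cmod (h f i))\<^sup>2) \<le> B\<^sup>2 * (\<Sum>\<^sub>\<infinity>i. (cmod (f i))\<^sup>2)"
    if f: "(\<lambda>i. (cmod (f i))\<^sup>2) summable_on UNIV" for f
  proof -
    have le: "(cmod (h f (s k)))\<^sup>2 \<le> B\<^sup>2 * (cmod (f k))\<^sup>2" for k
    proof -
      have "cmod (h f (s k)) = \<bar>w k\<bar> * cmod (f k)"
        unfolding hs norm_mult by simp
      also have "\<dots> \<le> B * cmod (f k)"
        by (intro mult_right_mono B) simp
      finally show ?thesis
        unfolding power_mult_distrib[symmetric] by (intro power_mono) simp_all
    qed
    have sB: "(\<lambda>k. B\<^sup>2 * (cmod (f k))\<^sup>2) summable_on UNIV"
      by (intro summable_on_cmult_right f)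
    have 1: "(\<lambda>k. (cmod (h f (s k)))\<^sup>2) summable_on UNIV"
      by (rule summable_on_comparison_test[OF sB]) (use le in auto)
    have 2: "(\<lambda>i. (cmod (h f i))\<^sup>2) summable_on range s"
      using 1 summable_on_reindex[OF s, of "\<lambda>i. (cmod (h f i))\<^sup>2"] by (simp add: o_def)
    have 3: "(\<lambda>i. (cmod (h f i))\<^sup>2) summable_on UNIV"
      using 2 by (rule summable_on_cong_neutral[THEN iffD1, rotated -1]) (auto simp: h_def)
    have "(\<Sum>\<^sub>\<infinity>i. (cmod (h f i))\<^sup>2) = (\<Sum>\<^sub>\<infinity>i\<in>range s. (cmod (h f i))\<^sup>2)"
      by (rule infsum_cong_neutral) (auto simp: h_def)
    also have "\<dots> = (\<Sum>\<^sub>\<infinity>k. (cmod (h f (s k)))\<^sup>2)"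
      using infsum_reindex[OF s, of "\<lambda>i. (cmod (h f i))\<^sup>2"] by (simp add: o_def)
    also have "\<dots> \<le> (\<Sum>\<^sub>\<infinity>k. B\<^sup>2 * (cmod (f k))\<^sup>2)"
      by (intro infsum_mono 1 sB le)
    also have "\<dots> = B\<^sup>2 * (\<Sum>\<^sub>\<infinity>i. (cmod (f i))\<^sup>2)"
      by (intro infsum_cmult_right f)
    finally show ?thesis using 3 by blast
  qed
  define T where "T x = Abs_ell2 (h (ell2_coord x))" for x
  have T: "ell2_coord (T x) = h (ell2_coord x)" for x
    unfolding T_def using aux[of "ell2_coord x"] ell2_coord[of x] by (subst Abs_ell2_inverse) auto
  have eqI: "x = y" if "\<And>i. ell2_coord x i = ell2_coord y i" for x y :: "'i ell2"
    using that by (simp add: ell2_coord_inject[symmetric] fun_eq_iff)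
  have "bounded_linear T"
  proof (rule bounded_linear_intro[of _ B])
    fix x y r
    show "T (x + y) = T x + T y"
      by (rule eqI) (simp add: T plus_ell2.rep_eq h_def distrib_left)
    show "T (r *\<^sub>R x) = r *\<^sub>R T x"
      by (rule eqI) (simp add: T scaleR_ell2.rep_eq h_def)
    have "norm (T x) \<le> sqrt (B\<^sup>2 * (\<Sum>\<^sub>\<infinity>i. (cmod (ell2_coord x i))\<^sup>2))"
      using aux[of "ell2_coord x"] ell2_coord[of x] by (simp add: norm_ell2_def T)
    then show "norm (T x) \<le> norm x * B"
      using B0 by (simp add: norm_ell2_def real_sqrt_mult mult.commute)
  qed
  moreover have "T (c *\<^sub>C x) = c *\<^sub>C T x" for c x
    by (rule eqI) (simp add: T scaleC.rep_eq h_def)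
  moreover have "T (ket k) = complex_of_real (w k) *\<^sub>C ket (s k)" for k
    by (rule eqI) (auto simp: T scaleC.rep_eq ket.rep_eq h_def s)
  ultimately show ?thesis unfolding bounded_clinear_def by blast
qed

lemma has_sum_ket:
  fixes x :: "'i ell2"
  shows "((\<lambda>i. ell2_coord x i *\<^sub>C ket i) has_sum x) UNIV"
proof -
  define f where "f i = (cmod (ell2_coord x i))\<^sup>2" for i
  have f: "f summable_on UNIV" using ell2_coord[of x] by (simp add: f_def[abs_def])
  have coord_sum: "ell2_coord (\<Sum>k\<in>F. ell2_coord x k *\<^sub>C ket k) i = (if i \<in> F then ell2_coord x i else 0)"
    if "finite F" for F i
    using that by (induction F) (auto simp: zero_ell2.rep_eq plus_ell2.rep_eq scaleC.rep_eq ket.rep_eq)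
  have nrm: "norm (x - (\<Sum>k\<in>F. ell2_coord x k *\<^sub>C ket k)) = sqrt (infsum f UNIV - sum f F)" if F: "finite F" for F
  proof -
    have "norm (x - (\<Sum>k\<in>F. ell2_coord x k *\<^sub>C ket k)) = sqrt (infsum f (UNIV - F))"
      unfolding norm_ell2_def minus_ell2.rep_eq coord_sum[OF F]
      by (rule arg_cong[of _ _ sqrt], rule infsum_cong_neutral) (auto simp: f_def)
    also have "infsum f (UNIV - F) = infsum f UNIV - sum f F"
      using infsum_Diff[OF f, of F] F by (simp)
    finally show ?thesis .
  qed
  have "(sum f \<longlongrightarrow> infsum f UNIV) (finite_subsets_at_top UNIV)"
    using f has_sum_def has_sum_infsum by blast
  then have "((\<lambda>F. sqrt (infsum f UNIV - sum f F)) \<longlongrightarrow> sqrt (infsum f UNIV - infsum f UNIV)) (finite_subsets_at_top UNIV)"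
    by (intro tendsto_intros)
  then have "((\<lambda>F. norm (x - (\<Sum>k\<in>F. ell2_coord x k *\<^sub>C ket k))) \<longlongrightarrow> 0) (finite_subsets_at_top UNIV)"
    by (rule Lim_transform_eventually[THEN tendsto_eq_rhs])
      (auto simp: nrm intro!: eventually_finite_subsets_at_top_weakI)
  then show ?thesis
    unfolding has_sum_def by (subst tendsto_dist_iff) (simp add: dist_norm norm_minus_commute)
qed

lemma eq_on_ket:
  assumes "bounded_clinear S" "bounded_clinear T" "\<And>k. S (ket k) = T (ket k)"
  shows "S = T"
proof
  fix x
  have 1: "((\<lambda>i. ell2_coord x i *\<^sub>C S (ket i)) has_sum S x) UNIV"
    using has_sum_bounded_linear[of S, OF _ has_sum_ket[of x]] assms by (simp add: bounded_clinear_def)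
  have 2: "((\<lambda>i. ell2_coord x i *\<^sub>C T (ket i)) has_sum T x) UNIV"
    using has_sum_bounded_linear[of T, OF _ has_sum_ket[of x]] assms by (simp add: bounded_clinear_def)
  show "S x = T x" using 1 2 assms(3) has_sum_unique by fastforce
qed
definition ker :: "'i op \<Rightarrow> 'i ell2 set" where
  "ker T = {x. T x = 0}"

definition cadjoint :: "'i op \<Rightarrow> 'i op" where
  "cadjoint T = (THE S. \<forall>x y. cinner (T x) y = cinner x (S y))"

definition positive_op :: "'i op \<Rightarrow> bool" where
  "positive_op A \<longleftrightarrow> bounded_clinear A \<and> (\<forall>x. cinner (A x) x \<in> \<real>\<^sub>\<ge>\<^sub>0)"

definition op_sqrt :: "'i op \<Rightarrow> 'i op" where
  "op_sqrt A = (THE R. positive_op R \<and> R \<circ> R = A)"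

definition op_abs :: "'i op \<Rightarrow> 'i op" where
  "op_abs T = op_sqrt (cadjoint T \<circ> T)"

text \<open>A partial isometry is isometric on the orthogonal complement of its kernel.\<close>

definition partial_isometry :: "'i op \<Rightarrow> bool" where
  "partial_isometry V \<longleftrightarrow> bounded_clinear V \<and>
     (\<forall>x. (\<forall>y\<in>ker V. cinner x y = 0) \<longrightarrow> norm (V x) = norm x)"

definition polar_factor :: "'i op \<Rightarrow> 'i op" where
  "polar_factor T = (THE V. partial_isometry V \<and> T = V \<circ> op_abs T \<and> ker V = ker T)"

definition aluthge :: "'i op \<Rightarrow> 'i op" where
  "aluthge T = op_sqrt (op_abs T) \<circ> polar_factor T \<circ> op_sqrt (op_abs T)"


section \<open>Pairs of operators\<close>

definition toral_aluthge :: "'i op \<times> 'i op \<Rightarrow> 'i op \<times> 'i op" where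
  "toral_aluthge = (\<lambda>(T1, T2). (aluthge T1, aluthge T2))"

definition spherical_abs :: "'i op \<times> 'i op \<Rightarrow> 'i op" where
  "spherical_abs = (\<lambda>(T1, T2). op_sqrt (\<lambda>x. cadjoint T1 (T1 x) + cadjoint T2 (T2 x)))"

definition spherical_polar_factor :: "'i op \<times> 'i op \<Rightarrow> 'i op \<times> 'i op" where
  "spherical_polar_factor T = (THE (U1, U2). bounded_clinear U1 \<and> bounded_clinear U2 \<and>
     T = (U1 \<circ> spherical_abs T, U2 \<circ> spherical_abs T) \<and>
     ker U1 \<inter> ker U2 = ker (spherical_abs T))"

definition spherical_aluthge :: "'i op \<times> 'i op \<Rightarrow> 'i op \<times> 'i op" where
  "spherical_aluthge T =
     (let R = op_sqrt (spherical_abs T); (U1, U2) = spherical_polar_factor T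
      in (R \<circ> U1 \<circ> R, R \<circ> U2 \<circ> R))"

definition commutator :: "'i op \<Rightarrow> 'i op \<Rightarrow> 'i op" where
  "commutator A B = (\<lambda>x. A (B x) - B (A x))"

text \<open>The operator matrix acts on $(x, y)$ in the direct sum of two copies of the space, on which
  the inner product is the sum of the inner products of the components.\<close>

definition jointly_hyponormal :: "'i op \<times> 'i op \<Rightarrow> bool" where
  "jointly_hyponormal = (\<lambda>(S1, S2). bounded_clinear S1 \<and> bounded_clinear S2 \<and>
     (\<forall>x y.
        cinner (commutator (cadjoint S1) S1 x + commutator (cadjoint S2) S1 y) x +
        cinner (commutator (cadjoint S1) S2 x + commutator (cadjoint S2) S2 y) y \<in> \<real>\<^sub>\<ge>\<^sub>0))"


section \<open>Two-variable weighted shifts\<close>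

definition weighted_shift2 ::
  "(nat \<times> nat \<Rightarrow> real) \<Rightarrow> (nat \<times> nat \<Rightarrow> real) \<Rightarrow> (nat \<times> nat) op \<times> (nat \<times> nat) op" where
  "weighted_shift2 \<alpha> \<beta> =
     ((THE T. bounded_clinear T \<and>
         (\<forall>k1 k2. T (ket (k1, k2)) = complex_of_real (\<alpha> (k1, k2)) *\<^sub>C ket (k1 + 1, k2))),
      (THE T. bounded_clinear T \<and>
         (\<forall>k1 k2. T (ket (k1, k2)) = complex_of_real (\<beta> (k1, k2)) *\<^sub>C ket (k1, k2 + 1))))"

definition Theta :: "(nat \<Rightarrow> real) \<Rightarrow> (nat \<times> nat) op \<times> (nat \<times> nat) op" where
  "Theta \<omega> = weighted_shift2 (\<lambda>(k1, k2). \<omega> (k1 + k2)) (\<lambda>(k1, k2). \<omega> (k1 + k2))"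

text \<open>For bounded weights both definite descriptions denote.\<close>

lemma weighted_shift2_props:
  assumes "bounded (range \<alpha>)" "bounded (range \<beta>)" "weighted_shift2 \<alpha> \<beta> = (T1, T2)"
  shows "bounded_clinear T1" "bounded_clinear T2"
    and "T1 (ket (k1, k2)) = complex_of_real (\<alpha> (k1, k2)) *\<^sub>C ket (k1 + 1, k2)"
    and "T2 (ket (k1, k2)) = complex_of_real (\<beta> (k1, k2)) *\<^sub>C ket (k1, k2 + 1)"
proof -
  have "\<exists>!T. bounded_clinear T \<and>
      (\<forall>k1 k2. T (ket (k1, k2)) = complex_of_real (\<alpha> (k1, k2)) *\<^sub>C ket (k1 + 1, k2))"
    using shift_exists[of "\<lambda>(k1, k2). (k1 + 1, k2)", OF _ assms(1)]
    by (auto simp: inj_def intro!: eq_on_ket)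
  from theI'[OF this] show "bounded_clinear T1"
      "T1 (ket (k1, k2)) = complex_of_real (\<alpha> (k1, k2)) *\<^sub>C ket (k1 + 1, k2)"
    using assms(3) by (auto simp: weighted_shift2_def)
  have "\<exists>!T. bounded_clinear T \<and>
      (\<forall>k1 k2. T (ket (k1, k2)) = complex_of_real (\<beta> (k1, k2)) *\<^sub>C ket (k1, k2 + 1))"
    using shift_exists[of "\<lambda>(k1, k2). (k1, k2 + 1)", OF _ assms(2)]
    by (auto simp: inj_def intro!: eq_on_ket)
  from theI'[OF this] show "bounded_clinear T2"
      "T2 (ket (k1, k2)) = complex_of_real (\<beta> (k1, k2)) *\<^sub>C ket (k1, k2 + 1)"
    using assms(3) by (auto simp: weighted_shift2_def)
qed

end

theory Submission
  imports Defs
begin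

text \<open>Both Aluthge transforms of \<^term>\<open>Theta \<omega>\<close> are \<open>Theta\<close> of the single sequence
  $\sqrt{\omega_n\omega_{n+1}}$, and \<^term>\<open>Theta \<omega>\<close> is jointly hyponormal iff $\omega$ is
  increasing. For the latter, $\|T_1x\| = \|T_2x\|$ turns the quadratic form of the operator
  matrix into $\|T_2x+T_1y\|^2 - \|T_1^*x+T_2^*y\|^2$, and the coordinates of the two vectors at
  $\mathbf k+\varepsilon_1+\varepsilon_2$ and $\mathbf k$ are $\omega_{n+1}z$ and $\omega_nz$,
  where $n=k_1+k_2$ and $z = x_{\mathbf k+\varepsilon_1}+y_{\mathbf k+\varepsilon_2}$.\<close>

section \<open>Coordinates and inner products\<close>

lemma ell2_eqI: "(\<And>i. ell2_coord x i = ell2_coord y i) \<Longrightarrow> x = y"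
  by (simp add: ell2_coord_inject[symmetric] fun_eq_iff)

lemma summable_coord: "(\<lambda>i. (cmod (ell2_coord x i))\<^sup>2) summable_on UNIV"
  using ell2_coord[of x] by simp

lemma norm_ell2_sq: "(norm x)\<^sup>2 = (\<Sum>\<^sub>\<infinity>i. (cmod (ell2_coord x i))\<^sup>2)" for x :: "'i ell2"
  unfolding norm_ell2_def by (simp add: infsum_nonneg)

lemma cmod_coord_le_norm: "cmod (ell2_coord x i) \<le> norm x"
proof -
  have "(\<Sum>i\<in>{i}. (cmod (ell2_coord x i))\<^sup>2) \<le> (norm x)\<^sup>2"
    unfolding norm_ell2_sq by (intro finite_sum_le_infsum summable_coord) auto
  then show ?thesis by (simp add: abs_le_square_iff[symmetric])
qed

text \<open>Continuity of the coordinate functionals allows them to be applied term by term to the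
  basis expansion of a vector.\<close>

lemma bounded_linear_coord: "bounded_linear (\<lambda>x. ell2_coord x i)"
  by (rule bounded_linear_intro[of _ 1])
    (auto simp: plus_ell2.rep_eq scaleR_ell2.rep_eq cmod_coord_le_norm scaleR_conv_of_real)

lemma cinner_same: "cinner x x = complex_of_real ((norm x)\<^sup>2)"
proof (rule complex_eqI)
  show "Re (cinner x x) = Re (complex_of_real ((norm x)\<^sup>2))"
    by (simp add: Re_cinner_same norm_ell2_sq)
  have "Im (cinner x x) = - Im (cinner x x)"
    using cinner_commute[of x x] by (metis cnj.sel(2))
  then have "Im (cinner x x) = 0" by linarith
  then show "Im (cinner x x) = Im (complex_of_real ((norm x)\<^sup>2))" by simp
qed

lemma cinner_add_right: "cinner x (y + z) = cinner x y + cinner x z"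
  using cinner_add_left[of y z x] by (metis cinner_commute complex_cnj_add)

lemma cinner_zero_left: "cinner 0 y = 0"
  by (simp add: cinner_def zero_ell2.rep_eq)

lemma cinner_diff_left: "cinner (x - y) z = cinner x z - cinner y z"
  using cinner_add_left[of "x - y" y z] by simp

lemma cinner_ket_right: "cinner x (ket i) = ell2_coord x i"
proof -
  have "cinner x (ket i) = (\<Sum>\<^sub>\<infinity>j\<in>{i}. ell2_coord x j)"
    unfolding cinner_def by (rule infsum_cong_neutral) (auto simp: ket.rep_eq)
  then show ?thesis by simp
qed

lemma norm_ket [simp]: "norm (ket i) = 1"
proof -
  have "complex_of_real ((norm (ket i))\<^sup>2) = 1"
    unfolding cinner_same[symmetric] cinner_ket_right by (simp add: ket.rep_eq)
  then have "(norm (ket i))\<^sup>2 = 1" using of_real_eq_1_iff by blast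
  then show ?thesis by (simp add: power2_eq_1_iff) (use norm_ge_zero[of "ket i"] in linarith)
qed

lemma norm_scaleC: "norm (c *\<^sub>C x) = cmod c * norm x"
proof (rule power2_eq_imp_eq)
  show "(norm (c *\<^sub>C x))\<^sup>2 = (cmod c * norm x)\<^sup>2"
    unfolding power_mult_distrib norm_ell2_sq
    by (simp add: scaleC.rep_eq norm_mult power_mult_distrib infsum_cmult_right summable_coord)
qed auto

lemma scaleC_scaleC: "a *\<^sub>C b *\<^sub>C x = (a * b) *\<^sub>C x"
  by (rule ell2_eqI) (simp add: scaleC.rep_eq)

lemma scaleC_one [simp]: "1 *\<^sub>C x = x"
  by (rule ell2_eqI) (simp add: scaleC.rep_eq)

lemma bounded_clinear_comp:
  "bounded_clinear S \<Longrightarrow> bounded_clinear T \<Longrightarrow> bounded_clinear (S \<circ> T)"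
  unfolding bounded_clinear_def using bounded_linear_compose[of S T] by (simp add: o_def)

lemma bounded_clinear_scaleC: "bounded_clinear T \<Longrightarrow> T (c *\<^sub>C x) = c *\<^sub>C T x"
  by (simp add: bounded_clinear_def)

lemma bounded_clinear_diff: "bounded_clinear T \<Longrightarrow> T (x - y) = T x - T y"
  by (simp add: bounded_clinear_def bounded_linear.linear linear_diff)

lemma bounded_clinear_zero: "bounded_clinear T \<Longrightarrow> T 0 = 0"
  by (simp add: bounded_clinear_def bounded_linear.linear linear_0)

text \<open>Pairing with \<open>ket i\<close> recovers the coordinates of \<open>S y\<close>, so at
  most one map satisfies the adjoint identity and the definite description picks it.\<close>

lemma cadjoint_eqI:
  assumes "\<And>x y. cinner (T x) y = cinner x (S y)"
  shows "cadjoint T = S"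
  unfolding cadjoint_def
proof (rule the_equality)
  fix S' assume S': "\<forall>x y. cinner (T x) y = cinner x (S' y)"
  have "ell2_coord (S' y) i = ell2_coord (S y) i" for y i
    using S' assms by (metis cinner_commute cinner_ket_right)
  then show "S' = S" by (auto intro: ell2_eqI)
qed (use assms in blast)

section \<open>Weighted translations of the basis\<close>

text \<open>One family covers both components of \<open>Theta\<close> and, with the identity as
  translation, all diagonal operators; the factors of the polar decompositions are again of this
  form, so the transforms reduce to arithmetic of weights.\<close>

definition wshift :: "('i \<Rightarrow> 'i) \<Rightarrow> ('i \<Rightarrow> real) \<Rightarrow> 'i op" where
  "wshift s w =
     (THE T. bounded_clinear T \<and> (\<forall>k. T (ket k) = complex_of_real (w k) *\<^sub>C ket (s k)))"

abbreviation diag_op :: "('i \<Rightarrow> real) \<Rightarrow> 'i op" where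
  "diag_op \<equiv> wshift (\<lambda>k. k)"

lemma wshift_props:
  assumes "inj s" "bounded (range w)"
  shows bounded_clinear_wshift: "bounded_clinear (wshift s w)"
    and wshift_ket: "wshift s w (ket k) = complex_of_real (w k) *\<^sub>C ket (s k)"
proof -
  have "\<exists>!T. bounded_clinear T \<and> (\<forall>k. T (ket k) = complex_of_real (w k) *\<^sub>C ket (s k))"
    using shift_exists[OF assms] by (auto intro!: eq_on_ket)
  from theI'[OF this] show "bounded_clinear (wshift s w)"
    "wshift s w (ket k) = complex_of_real (w k) *\<^sub>C ket (s k)"
    by (auto simp: wshift_def)
qed

lemma wshift_eqI:
  assumes "inj s" "bounded (range w)" "bounded_clinear T"
    and "\<And>k. T (ket k) = complex_of_real (w k) *\<^sub>C ket (s k)"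
  shows "T = wshift s w"
  by (rule eq_on_ket) (use assms wshift_props[OF assms(1,2)] in auto)

text \<open>The basis expansion of \<open>x\<close> is pushed first through the bounded operator and
  then through the \<open>j\<close>-th coordinate functional.\<close>

lemma wshift_coord_has_sum:
  assumes "inj s" "bounded (range w)"
  shows "((\<lambda>k. ell2_coord x k * (complex_of_real (w k) * (if j = s k then 1 else 0))) has_sum
    ell2_coord (wshift s w x) j) UNIV"
proof -
  have "((\<lambda>k. wshift s w (ell2_coord x k *\<^sub>C ket k)) has_sum wshift s w x) UNIV"
    using has_sum_bounded_linear[OF _ has_sum_ket[of x]] bounded_clinear_wshift[OF assms]
    unfolding bounded_clinear_def by blast
  from has_sum_bounded_linear[OF bounded_linear_coord[of j] this] show ?thesis
    by (simp add: bounded_clinear_scaleC bounded_clinear_wshift wshift_ket assms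
        scaleC.rep_eq ket.rep_eq)
qed

text \<open>Since \<open>s\<close> is injective, only the term with index \<open>k\<close> survives
  in the series for the coordinate at \<open>s k\<close>.\<close>

lemma wshift_coord:
  assumes "inj s" "bounded (range w)"
  shows "ell2_coord (wshift s w x) (s k) = w k * ell2_coord x k"
proof -
  have "((\<lambda>j. ell2_coord x j * (complex_of_real (w j) * (if s k = s j then 1 else 0))) has_sum
      w k * ell2_coord x k) {k}"
    using has_sum_finite[of "{k}" "\<lambda>j. ell2_coord x j * (complex_of_real (w j) * (if s k = s j then 1 else 0))"]
    by (simp add: mult.commute)
  then have "((\<lambda>j. ell2_coord x j * (complex_of_real (w j) * (if s k = s j then 1 else 0))) has_sum
      w k * ell2_coord x k) UNIV"
    by (rule has_sum_cong_neutral[THEN iffD1, rotated -1])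
      (use assms(1) in \<open>auto dest: injD\<close>)
  then show ?thesis using wshift_coord_has_sum[OF assms] has_sum_unique by blast
qed

lemma wshift_coord_zero:
  assumes "inj s" "bounded (range w)" "j \<notin> range s"
  shows "ell2_coord (wshift s w x) j = 0"
proof -
  have "((\<lambda>k. ell2_coord x k * (complex_of_real (w k) * (if j = s k then 1 else 0))) has_sum 0) UNIV"
    using assms(3) by (intro has_sum_0) auto
  then show ?thesis using wshift_coord_has_sum[OF assms(1,2)] has_sum_unique by blast
qed

lemmas diag_coord = wshift_coord[of "\<lambda>k. k", simplified]
lemmas diag_ket = wshift_ket[of "\<lambda>k. k", simplified]
lemmas bounded_clinear_diag = bounded_clinear_wshift[of "\<lambda>k. k", simplified]

text \<open>Indices outside \<open>range s\<close> contribute \<open>f i 0 = 0\<close>, and the rest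
  is reindexed along \<open>s\<close>. The general \<open>f\<close> serves both squared norms and
  inner products.\<close>

lemma infsum_wshift:
  fixes f :: "'i \<Rightarrow> complex \<Rightarrow> 'b :: {comm_monoid_add, t2_space}"
  assumes "inj s" "bounded (range w)" "\<And>i. f i 0 = 0"
  shows "(\<Sum>\<^sub>\<infinity>i. f i (ell2_coord (wshift s w x) i)) = (\<Sum>\<^sub>\<infinity>k. f (s k) (w k * ell2_coord x k))"
proof -
  have "(\<Sum>\<^sub>\<infinity>i. f i (ell2_coord (wshift s w x) i))
      = (\<Sum>\<^sub>\<infinity>i\<in>range s. f i (ell2_coord (wshift s w x) i))"
    by (rule infsum_cong_neutral) (auto simp: wshift_coord_zero[OF assms(1,2)] assms(3))
  also have "\<dots> = (\<Sum>\<^sub>\<infinity>k. f (s k) (w k * ell2_coord x k))"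
    using infsum_reindex[OF assms(1), of "\<lambda>i. f i (ell2_coord (wshift s w x) i)"]
    by (simp add: o_def wshift_coord[OF assms(1,2)])
  finally show ?thesis .
qed

section \<open>Norm, kernel and adjoint of a weighted translation\<close>

lemma norm_wshift:
  assumes "inj s" "bounded (range w)"
  shows "(norm (wshift s w x))\<^sup>2 = (\<Sum>\<^sub>\<infinity>k. (cmod (w k * ell2_coord x k))\<^sup>2)"
  unfolding norm_ell2_sq by (rule infsum_wshift[OF assms, of "\<lambda>_ z. (cmod z)\<^sup>2"]) simp

lemma wshift_eq_0_iff:
  assumes "inj s" "bounded (range w)" "\<And>k. w k \<noteq> 0"
  shows "wshift s w x = 0 \<longleftrightarrow> x = 0"
proof
  assume "wshift s w x = 0"
  then have "ell2_coord x k = 0" for k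
    using wshift_coord[OF assms(1,2), of x k] assms(3)[of k] by (simp add: zero_ell2.rep_eq)
  then show "x = 0" by (auto intro: ell2_eqI simp: zero_ell2.rep_eq)
qed (simp add: bounded_clinear_zero bounded_clinear_wshift assms)

lemma adjoint_wshift_summable:
  fixes w :: "'i \<Rightarrow> real"
  assumes "inj s" "bounded (range w)"
  shows "(\<lambda>k. (cmod (w k * ell2_coord y (s k)))\<^sup>2) summable_on UNIV"
proof -
  obtain B where B: "\<And>k. \<bar>w k\<bar> \<le> B" using assms(2) by (auto simp: bounded_iff)
  have "(\<lambda>i. (cmod (ell2_coord y i))\<^sup>2) summable_on range s"
    using summable_coord by (rule summable_on_subset_banach) simp
  then have *: "(\<lambda>k. (cmod (ell2_coord y (s k)))\<^sup>2) summable_on UNIV"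
    using summable_on_reindex[OF assms(1), of "\<lambda>i. (cmod (ell2_coord y i))\<^sup>2"] by (simp add: o_def)
  show ?thesis
  proof (rule summable_on_comparison_test[OF summable_on_cmult_right[OF *, of "B\<^sup>2"]])
    fix k
    show "(cmod (w k * ell2_coord y (s k)))\<^sup>2 \<le> B\<^sup>2 * (cmod (ell2_coord y (s k)))\<^sup>2"
      using power_mono[OF B[of k], of 2]
      by (simp add: norm_mult power_mult_distrib mult_right_mono)
  qed simp
qed

lemma
  assumes "inj s" "bounded (range w)"
  shows cadjoint_wshift_coord: "ell2_coord (cadjoint (wshift s w) y) k = w k * ell2_coord y (s k)"
    and cinner_cadjoint_wshift: "cinner x (cadjoint (wshift s w) y) = cinner (wshift s w x) y"
proof -
  \<comment> \<open>The candidate adjoint is given by its coordinates; real weights need no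
    conjugation, and square-summability makes \<open>Abs_ell2\<close> meaningful here.\<close>
  define S where "S y = Abs_ell2 (\<lambda>k. w k * ell2_coord y (s k))" for y
  have S: "ell2_coord (S y) k = w k * ell2_coord y (s k)" for y k
    unfolding S_def using adjoint_wshift_summable[OF assms] by (subst Abs_ell2_inverse) auto
  have adj: "cinner (wshift s w x) y = cinner x (S y)" for x y
    unfolding cinner_def
    using infsum_wshift[OF assms, of "\<lambda>i z. z * cnj (ell2_coord y i)" x]
    by (simp add: S mult_ac)
  have "cadjoint (wshift s w) = S" by (rule cadjoint_eqI) (rule adj)
  then show "ell2_coord (cadjoint (wshift s w) y) k = w k * ell2_coord y (s k)"
    "cinner x (cadjoint (wshift s w) y) = cinner (wshift s w x) y"
    using S adj by auto
qed

lemma cinner_cadjoint_wshift':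
  assumes "inj s" "bounded (range w)"
  shows "cinner (cadjoint (wshift s w) y) x = cinner y (wshift s w x)"
  using cinner_cadjoint_wshift[OF assms, of x y] by (metis cinner_commute)

section \<open>Bounded weights and positive diagonal operators\<close>

lemma bounded_range_sqrt:
  assumes "bounded (range d)" "\<And>k. 0 < d k"
  shows "bounded (range (\<lambda>k. sqrt (d k)))"
proof -
  obtain B where "\<And>k. \<bar>d k\<bar> \<le> B" using assms(1) by (auto simp: bounded_iff)
  then have "\<bar>sqrt (d k)\<bar> \<le> sqrt B" for k
    using assms(2)[of k] by (simp add: abs_le_iff)
  then show ?thesis by (auto simp: bounded_iff)
qed

lemma bounded_range_mult:
  fixes f g :: "'a \<Rightarrow> real"
  assumes "bounded (range f)" "bounded (range g)"
  shows "bounded (range (\<lambda>k. f k * g k))"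
proof -
  obtain B where B: "\<And>k. \<bar>f k\<bar> \<le> B" using assms(1) by (auto simp: bounded_iff)
  obtain C where C: "\<And>k. \<bar>g k\<bar> \<le> C" using assms(2) by (auto simp: bounded_iff)
  have "\<bar>f k * g k\<bar> \<le> B * C" for k
    unfolding abs_mult using B[of k] C[of k] by (intro mult_mono) auto
  then show ?thesis by (auto simp: bounded_iff)
qed

text \<open>Writing the quadratic form as a squared norm yields both positivity of
  \<open>diag_op d\<close> and, below, that the form vanishes only at 0.\<close>

lemma cinner_diag_sqrt:
  assumes "bounded (range d)" "\<And>k. 0 < d k"
  shows "cinner (diag_op d x) x =
    cinner (diag_op (\<lambda>k. sqrt (d k)) x) (diag_op (\<lambda>k. sqrt (d k)) x)"
  unfolding cinner_def diag_coord[OF assms(1)] diag_coord[OF bounded_range_sqrt[OF assms]]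
  using less_imp_le[OF assms(2)] by (simp add: mult_ac flip: of_real_mult)

lemma positive_diag:
  assumes "bounded (range d)" "\<And>k. 0 < d k"
  shows "positive_op (diag_op d)"
  using bounded_clinear_diag[OF assms(1)]
  by (simp add: positive_op_def cinner_diag_sqrt[OF assms] cinner_same)

section \<open>Polar decompositions and Aluthge transforms\<close>

lemma diag_comp_sqrt:
  assumes "bounded (range d)" "\<And>k. 0 < d k"
  shows "diag_op (\<lambda>k. sqrt (d k)) (diag_op (\<lambda>k. sqrt (d k)) x) = diag_op d x"
  using less_imp_le[OF assms(2)]
  by (intro ell2_eqI) (simp add: diag_coord bounded_range_sqrt assms flip: of_real_mult mult.assoc)

lemma diag_inner_zero:
  assumes "bounded (range d)" "\<And>k. 0 < d k" "cinner (diag_op d x) x = 0"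
  shows "x = 0"
proof -
  have "diag_op (\<lambda>k. sqrt (d k)) x = 0"
    using assms(3) by (simp add: cinner_diag_sqrt[OF assms(1,2)] cinner_same)
  then show ?thesis
    using wshift_eq_0_iff[of "\<lambda>k. k" "\<lambda>k. sqrt (d k)" x] bounded_range_sqrt[OF assms(1,2)] assms(2)
    by (simp add: less_imp_neq[symmetric])
qed

text \<open>The entrywise root is one positive root. Uniqueness is shown without spectral theory:
  another positive root \<open>R\<close> commutes with it, and a difference of squares argument
  makes the two agree.\<close>

lemma op_sqrt_diag:
  assumes d: "bounded (range d)" "\<And>k. 0 < d k"
  shows "op_sqrt (diag_op d) = diag_op (\<lambda>k. sqrt (d k))"
  unfolding op_sqrt_def
proof (rule the_equality)
  let ?S = "diag_op (\<lambda>k. sqrt (d k))"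
  note bS = bounded_range_sqrt[OF d]
  have S: "positive_op ?S" using positive_diag[OF bS] d(2) by simp
  have SS: "?S (?S x) = diag_op d x" for x by (rule diag_comp_sqrt[OF d])
  then show "positive_op ?S \<and> ?S \<circ> ?S = diag_op d" using S by auto
  fix R assume R: "positive_op R \<and> R \<circ> R = diag_op d"
  then have RR: "R (R x) = diag_op d x" for x by (metis comp_apply)
  have bR: "bounded_clinear R" using R by (simp add: positive_op_def)
  have bSc: "bounded_clinear ?S" using S by (simp add: positive_op_def)
  \<comment> \<open>\<^term>\<open>R\<close> commutes with \<^term>\<open>diag_op d\<close>, so its matrix entries vanish between
    distinct eigenvalues; hence it also commutes with \<^term>\<open>diag_op (\<lambda>k. sqrt (d k))\<close>.\<close>
  have "R (?S (ket k)) = ?S (R (ket k))" for k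
  proof (rule ell2_eqI)
    fix j
    have "R (diag_op d (ket k)) = diag_op d (R (ket k))" by (simp flip: RR)
    then have "complex_of_real (d k) *\<^sub>C R (ket k) = diag_op d (R (ket k))"
      by (simp only: diag_ket[OF d(1)] bounded_clinear_scaleC[OF bR])
    from arg_cong[OF this, of "\<lambda>x. ell2_coord x j"]
    have "d k * ell2_coord (R (ket k)) j = d j * ell2_coord (R (ket k)) j"
      by (simp only: scaleC.rep_eq diag_coord[OF d(1)])
    then have "sqrt (d k) * ell2_coord (R (ket k)) j = sqrt (d j) * ell2_coord (R (ket k)) j"
      by auto
    then show "ell2_coord (R (?S (ket k))) j = ell2_coord (?S (R (ket k))) j"
      by (simp add: diag_ket bS bounded_clinear_scaleC[OF bR] scaleC.rep_eq diag_coord)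
  qed
  then have "R \<circ> ?S = ?S \<circ> R"
    by (intro eq_on_ket bounded_clinear_comp bR bSc) simp
  then have comm: "R (?S x) = ?S (R x)" for x by (metis comp_apply)
  have "R x = ?S x" for x
  proof -
    \<comment> \<open>As \<open>R\<close> and \<open>?S\<close> commute and have the same square,
      \<open>R + ?S\<close> annihilates \<open>z\<close>. The two nonnegative forms at
      \<open>z\<close> then add up to 0, so both vanish, and strict positivity of the weights of
      \<open>?S\<close> forces \<open>z = 0\<close>.\<close>
    define z where "z = R x - ?S x"
    have "R z + ?S z = 0"
      unfolding z_def
      by (simp add: bounded_clinear_diff[OF bR] bounded_clinear_diff[OF bSc] RR SS comm)
    then have "cinner (R z) z + cinner (?S z) z = 0"
      by (simp add: cinner_zero_left flip: cinner_add_left)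
    moreover have "cinner (R z) z \<in> \<real>\<^sub>\<ge>\<^sub>0" "cinner (?S z) z \<in> \<real>\<^sub>\<ge>\<^sub>0"
      using R S by (auto simp: positive_op_def)
    ultimately have "cinner (?S z) z = 0"
      by (auto simp: complex_nonneg_Reals_iff complex_eq_iff)
    then have "z = 0" using diag_inner_zero[OF bS] d(2) by simp
    then show ?thesis by (simp add: z_def)
  qed
  then show "R = ?S" by blast
qed

section \<open>Moduli and polar factors of weighted translations\<close>

lemma cadjoint_wshift_wshift:
  assumes "inj s" "bounded (range w)"
  shows "cadjoint (wshift s w) (wshift s w x) = diag_op (\<lambda>k. (w k)\<^sup>2) x"
  using bounded_range_mult[OF assms(2,2)]
  by (intro ell2_eqI)
    (simp add: cadjoint_wshift_coord assms wshift_coord diag_coord power2_eq_square)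

lemma op_abs_wshift:
  assumes "inj s" "bounded (range w)" "\<And>k. 0 < w k"
  shows "op_abs (wshift s w) = diag_op w"
proof -
  have "cadjoint (wshift s w) \<circ> wshift s w = diag_op (\<lambda>k. (w k)\<^sup>2)"
    using cadjoint_wshift_wshift[OF assms(1,2)] by auto
  then show ?thesis
    using op_sqrt_diag[of "\<lambda>k. (w k)\<^sup>2"] bounded_range_mult[OF assms(2,2)] assms(3)
    by (simp add: op_abs_def power2_eq_square less_imp_le)
qed

text \<open>On \<open>ket k\<close> the diagonal factor is multiplication by \<open>p k\<close>,
  which can be divided out. This gives the uniqueness part of both the single and the spherical
  polar decomposition.\<close>

lemma unique_right_factor_diag:
  assumes "inj s" "bounded (range p)" "\<And>k. 0 < p k" "bounded (range v)" "bounded_clinear V"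
    and "V \<circ> diag_op p = wshift s w" "bounded (range w)" "\<And>k. v k = w k / p k"
  shows "V = wshift s v"
proof (rule wshift_eqI[OF assms(1,4,5)])
  fix k
  have "V (diag_op p (ket k)) = wshift s w (ket k)" using assms(6) by (metis comp_apply)
  then have "complex_of_real (p k) *\<^sub>C V (ket k) = complex_of_real (w k) *\<^sub>C ket (s k)"
    by (simp add: diag_ket assms wshift_ket bounded_clinear_scaleC)
  then have "complex_of_real (1 / p k) *\<^sub>C complex_of_real (p k) *\<^sub>C V (ket k)
      = complex_of_real (1 / p k) *\<^sub>C complex_of_real (w k) *\<^sub>C ket (s k)" by simp
  then show "V (ket k) = complex_of_real (v k) *\<^sub>C ket (s k)"
    using assms(3)[of k] by (simp add: scaleC_scaleC assms(8))
qed

lemma wshift_comp_diag: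
  assumes "inj s" "bounded (range v)" "bounded (range p)"
  shows "wshift s v \<circ> diag_op p = wshift s (\<lambda>k. v k * p k)"
  by (rule wshift_eqI)
    (auto simp: assms bounded_range_mult bounded_clinear_comp bounded_clinear_wshift
      bounded_clinear_diag diag_ket wshift_ket bounded_clinear_scaleC scaleC_scaleC mult.commute)

lemma diag_comp_wshift:
  assumes "inj s" "bounded (range v)" "bounded (range p)"
  shows "diag_op p \<circ> wshift s v = wshift s (\<lambda>k. p (s k) * v k)"
proof (rule wshift_eqI)
  have "bounded (range (\<lambda>k. p (s k)))" using assms(3) by (rule bounded_subset) auto
  then show "bounded (range (\<lambda>k. p (s k) * v k))" using assms(2) by (rule bounded_range_mult)
qed (auto simp: assms bounded_clinear_comp bounded_clinear_wshift
      bounded_clinear_diag diag_ket wshift_ket bounded_clinear_scaleC scaleC_scaleC mult.commute)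

text \<open>The modulus absorbs all the weights, leaving the unweighted translation, an isometry;
  all kernels concerned are trivial because the weights are positive.\<close>

lemma polar_factor_wshift:
  assumes s: "inj s" and w: "bounded (range w)" "\<And>k. 0 < w k"
  shows "polar_factor (wshift s w) = wshift s (\<lambda>_. 1)"
  unfolding polar_factor_def op_abs_wshift[OF assms]
proof (rule the_equality)
  have b1: "bounded (range (\<lambda>_. 1 :: real))" by simp
  have "norm (wshift s (\<lambda>_. 1) x) = norm x" for x
    using norm_wshift[OF s b1, of x] by (simp flip: norm_ell2_sq)
  moreover have "ker (wshift s (\<lambda>_. 1)) = {0}" "ker (wshift s w) = {0}"
    using wshift_eq_0_iff[OF s b1] wshift_eq_0_iff[OF s w(1)] w(2)
    by (auto simp: ker_def less_imp_neq[symmetric])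
  ultimately show "partial_isometry (wshift s (\<lambda>_. 1)) \<and>
      wshift s w = wshift s (\<lambda>_. 1) \<circ> diag_op w \<and> ker (wshift s (\<lambda>_. 1)) = ker (wshift s w)"
    using wshift_comp_diag[OF s b1 w(1)] bounded_clinear_wshift[OF s b1]
    by (simp add: partial_isometry_def)
  fix V assume V: "partial_isometry V \<and> wshift s w = V \<circ> diag_op w \<and> ker V = ker (wshift s w)"
  then show "V = wshift s (\<lambda>_. 1)"
    using w(2)
    by (intro unique_right_factor_diag[OF s w b1 _ _ w(1)])
      (auto simp: partial_isometry_def less_imp_neq[symmetric])
qed

lemma sandwich_wshift:
  assumes "inj s" "bounded (range v)" "bounded (range p)"
  shows "diag_op p \<circ> wshift s v \<circ> diag_op p = wshift s (\<lambda>k. p (s k) * v k * p k)"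
proof -
  have "bounded (range (\<lambda>k. p (s k)))" using assms(3) by (rule bounded_subset) auto
  then show ?thesis
    by (simp add: diag_comp_wshift wshift_comp_diag bounded_range_mult assms)
qed

text \<open>The right-hand root acts before the translation and contributes
  \<open>sqrt (w k)\<close>; the left-hand root acts after it and contributes
  \<open>sqrt (w (s k))\<close>.\<close>

lemma aluthge_wshift:
  assumes "inj s" "bounded (range w)" "\<And>k. 0 < w k"
  shows "aluthge (wshift s w) = wshift s (\<lambda>k. sqrt (w k * w (s k)))"
  unfolding aluthge_def op_abs_wshift[OF assms] op_sqrt_diag[OF assms(2,3)]
    polar_factor_wshift[OF assms]
  by (simp add: sandwich_wshift assms bounded_range_sqrt real_sqrt_mult mult.commute)

text \<open>The sum of the two operators \<open>T_i^* T_i\<close> is diagonal with entries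
  \<open>(a k)\<^sup>2 + (b k)\<^sup>2\<close>. Hence \<open>p\<close> lists the entries of the
  spherical modulus, and dividing the weights by \<open>p\<close> gives the polar factors.\<close>

lemma spherical_aluthge_wshift:
  assumes s: "inj s" "inj t" and b: "bounded (range a)" "bounded (range b)"
    and pos: "\<And>k. 0 < a k" "\<And>k. 0 < b k"
  defines "p \<equiv> \<lambda>k. sqrt ((a k)\<^sup>2 + (b k)\<^sup>2)"
  shows "spherical_aluthge (wshift s a, wshift t b) =
    (wshift s (\<lambda>k. sqrt (p (s k)) * (a k / p k) * sqrt (p k)),
     wshift t (\<lambda>k. sqrt (p (t k)) * (b k / p k) * sqrt (p k)))"
proof -
  have bq: "bounded (range (\<lambda>k. (a k)\<^sup>2))" "bounded (range (\<lambda>k. (b k)\<^sup>2))"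
    using bounded_range_mult[OF b(1) b(1)] bounded_range_mult[OF b(2) b(2)]
    by (simp_all add: power2_eq_square)
  have bq2: "bounded (range (\<lambda>k. (a k)\<^sup>2 + (b k)\<^sup>2))" by (rule bounded_plus_comp[OF bq])
  have q0: "0 < (a k)\<^sup>2 + (b k)\<^sup>2" for k using pos by (intro add_pos_pos zero_less_power)
  have p0: "0 < p k" for k using q0 by (simp add: p_def)
  have bp: "bounded (range p)"
    unfolding p_def by (rule bounded_range_sqrt[OF bq2 q0])
  have "(\<lambda>x. cadjoint (wshift s a) (wshift s a x) + cadjoint (wshift t b) (wshift t b x))
      = diag_op (\<lambda>k. (a k)\<^sup>2 + (b k)\<^sup>2)"
    by (intro ext ell2_eqI)
      (simp add: cadjoint_wshift_wshift s b plus_ell2.rep_eq diag_coord bq bq2 distrib_right)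
  then have P: "spherical_abs (wshift s a, wshift t b) = diag_op p"
    using op_sqrt_diag[OF bq2 q0] by (simp add: spherical_abs_def p_def)
  \<comment> \<open>The entries of \<open>p\<close> may come arbitrarily close to 0, so boundedness
    of the quotients has to come from comparing numerator and denominator.\<close>
  have "a k \<le> p k" "b k \<le> p k" for k
    unfolding p_def by (rule real_le_rsqrt; simp)+
  then have "\<bar>a k / p k\<bar> \<le> 1" "\<bar>b k / p k\<bar> \<le> 1" for k
    using pos[of k] p0[of k] by auto
  then have bu: "bounded (range (\<lambda>k. a k / p k))" "bounded (range (\<lambda>k. b k / p k))"
    by (auto simp: bounded_iff)
  have "spherical_polar_factor (wshift s a, wshift t b)
      = (wshift s (\<lambda>k. a k / p k), wshift t (\<lambda>k. b k / p k))" (is "_ = (?U, ?V)")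
    unfolding spherical_polar_factor_def P
  proof (rule the_equality, goal_cases)
    case 1
    have "?U \<circ> diag_op p = wshift s a" "?V \<circ> diag_op p = wshift t b"
      using p0 by (simp_all add: wshift_comp_diag s bu bp less_imp_neq[symmetric])
    moreover have "ker ?U = {0}" "ker ?V = {0}" "ker (diag_op p) = {0}"
      using wshift_eq_0_iff[OF s(1) bu(1)] wshift_eq_0_iff[OF s(2) bu(2)]
        wshift_eq_0_iff[of "\<lambda>k. k", OF _ bp] pos p0
      by (auto simp: ker_def less_imp_neq[symmetric])
    ultimately show ?case by (auto simp: bounded_clinear_wshift s bu)
  next
    case (2 UV)
    then obtain U V where UV: "UV = (U, V)" "bounded_clinear U" "bounded_clinear V"
      "U \<circ> diag_op p = wshift s a" "V \<circ> diag_op p = wshift t b"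
      by (cases UV) auto
    then show ?case
      using unique_right_factor_diag[OF s(1) bp p0 bu(1) UV(2,4) b(1)]
        unique_right_factor_diag[OF s(2) bp p0 bu(2) UV(3,5) b(2)] by simp
  qed
  then show ?thesis
    unfolding spherical_aluthge_def P op_sqrt_diag[OF bp p0]
    by (simp add: sandwich_wshift s bu bounded_range_sqrt bp p0)
qed

section \<open>The two-variable shift of a one-variable shift\<close>

abbreviation right :: "nat \<times> nat \<Rightarrow> nat \<times> nat" where
  "right \<equiv> \<lambda>(k1, k2). (Suc k1, k2)"

abbreviation up :: "nat \<times> nat \<Rightarrow> nat \<times> nat" where
  "up \<equiv> \<lambda>(k1, k2). (k1, Suc k2)"

abbreviation lev :: "(nat \<Rightarrow> real) \<Rightarrow> nat \<times> nat \<Rightarrow> real" where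
  "lev \<omega> \<equiv> \<lambda>(k1, k2). \<omega> (k1 + k2)"

lemma inj_right: "inj right" and inj_up: "inj up"
  by (auto simp: inj_def)

lemma Theta_wshift: "Theta \<omega> = (wshift right (lev \<omega>), wshift up (lev \<omega>))"
  by (simp add: Theta_def weighted_shift2_def wshift_def)

lemma bounded_lev: "bounded (range \<omega>) \<Longrightarrow> bounded (range (lev \<omega>))"
  by (erule bounded_subset) auto

text \<open>A step to the right and a step up both raise \<open>k1 + k2\<close> by one, so the two
  components keep equal weights and the pair stays of the form \<open>Theta\<close>.\<close>

lemma toral_aluthge_Theta:
  assumes "\<And>n. 0 < \<omega> n" "bounded (range \<omega>)"
  shows "toral_aluthge (Theta \<omega>) = Theta (\<lambda>n. sqrt (\<omega> n * \<omega> (Suc n)))"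
proof -
  let ?v = "lev (\<lambda>n. sqrt (\<omega> n * \<omega> (Suc n)))"
  note b = bounded_lev[OF assms(2)]
  have pos: "0 < lev \<omega> k" for k using assms(1) by (simp add: split_beta)
  have "(\<lambda>k. sqrt (lev \<omega> k * lev \<omega> (right k))) = ?v"
    "(\<lambda>k. sqrt (lev \<omega> k * lev \<omega> (up k))) = ?v" by auto
  then show ?thesis
    using aluthge_wshift[OF inj_right b pos] aluthge_wshift[OF inj_up b pos]
    unfolding toral_aluthge_def Theta_wshift by simp
qed

lemma spherical_aluthge_Theta:
  assumes "\<And>n. 0 < \<omega> n" "bounded (range \<omega>)"
  shows "spherical_aluthge (Theta \<omega>) = Theta (\<lambda>n. sqrt (\<omega> n * \<omega> (Suc n)))"
proof -
  let ?v = "lev (\<lambda>n. sqrt (\<omega> n * \<omega> (Suc n)))"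
  let ?p = "\<lambda>k. sqrt ((lev \<omega> k)\<^sup>2 + (lev \<omega> k)\<^sup>2)"
  note b = bounded_lev[OF assms(2)]
  have pos: "0 < lev \<omega> k" for k using assms(1) by (simp add: split_beta)
  have p: "?p = (\<lambda>k. sqrt 2 * lev \<omega> k)"
    using pos by (simp add: real_sqrt_mult less_imp_le flip: mult_2)
  \<comment> \<open>Here \<open>x\<close> is the weight at \<open>k\<close> and \<open>y\<close> the
    weight at the translated index. The two fourth roots of 2 cancel the \<open>sqrt 2\<close> in
    the denominator, which is why the spherical transform agrees with the toral one.\<close>
  have "sqrt (sqrt 2 * y) * (x / (sqrt 2 * x)) * sqrt (sqrt 2 * x) = sqrt (x * y)"
    if "0 < x" for x y :: real
  proof -
    have "sqrt (sqrt 2 * y) * (x / (sqrt 2 * x)) * sqrt (sqrt 2 * x)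
        = (sqrt (sqrt 2) * sqrt (sqrt 2)) / sqrt 2 * (sqrt x * sqrt y)"
      using that by (simp add: real_sqrt_mult del: real_sqrt_mult_self)
    then show ?thesis by (simp add: real_sqrt_mult)
  qed
  note this[OF pos]
  then have "(\<lambda>k. sqrt (?p (right k)) * (lev \<omega> k / ?p k) * sqrt (?p k)) = ?v"
    "(\<lambda>k. sqrt (?p (up k)) * (lev \<omega> k / ?p k) * sqrt (?p k)) = ?v"
    unfolding fun_cong[OF p] by (simp_all only:) auto
  then show ?thesis
    using spherical_aluthge_wshift[OF inj_right inj_up b b pos pos]
    unfolding Theta_wshift by simp
qed

section \<open>Joint hyponormality as monotonicity of the weights\<close>

lemma jointly_hyponormal_Theta_norm:
  assumes "bounded (range \<omega>)" "Theta \<omega> = (S, T)"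
  shows "jointly_hyponormal (Theta \<omega>) \<longleftrightarrow>
    (\<forall>x y. norm (cadjoint S x + cadjoint T y) \<le> norm (T x + S y))"
proof -
  note b = bounded_lev[OF assms(1)]
  have S: "S = wshift right (lev \<omega>)" and T: "T = wshift up (lev \<omega>)"
    using assms(2) by (auto simp: Theta_wshift)
  note adj = cinner_cadjoint_wshift[OF inj_right b, folded S] cinner_cadjoint_wshift[OF inj_up b, folded T]
    cinner_cadjoint_wshift'[OF inj_right b, folded S] cinner_cadjoint_wshift'[OF inj_up b, folded T]
  \<comment> \<open>The mixed terms of the form pair \<open>T x\<close> with \<open>S y\<close>, so
    the diagonal terms from \<open>S x\<close> and \<open>T y\<close> must be exchanged for those
    from \<open>T x\<close> and \<open>S y\<close> to complete the square.\<close>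
  have eq: "cadjoint S (S x) = cadjoint T (T x)" for x
    unfolding S T by (simp add: cadjoint_wshift_wshift inj_right inj_up b)
  have form: "cinner (commutator (cadjoint S) S x + commutator (cadjoint T) S y) x +
      cinner (commutator (cadjoint S) T x + commutator (cadjoint T) T y) y
    = complex_of_real ((norm (T x + S y))\<^sup>2 - (norm (cadjoint S x + cadjoint T y))\<^sup>2)" for x y
    unfolding of_real_diff cinner_same[symmetric] commutator_def
    by (simp add: cinner_add_left cinner_add_right cinner_diff_left)
      (simp add: adj(1,2) eq flip: adj(3,4))
  have "bounded_clinear S" "bounded_clinear T"
    unfolding S T by (rule bounded_clinear_wshift[OF inj_right b] bounded_clinear_wshift[OF inj_up b])+
  moreover have "complex_of_real (r\<^sup>2 - q\<^sup>2) \<in> \<real>\<^sub>\<ge>\<^sub>0 \<longleftrightarrow> q \<le> r" if "0 \<le> q" "0 \<le> r" for q r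
    using that by (simp add: nonneg_Reals_of_real_iff del: of_real_diff of_real_power)
  ultimately show ?thesis
    unfolding assms(2) jointly_hyponormal_def prod.case form by simp
qed

text \<open>For increasing weights the norm inequality holds coordinate by coordinate; conversely,
  one basis vector on the horizontal axis tests each pair of consecutive weights.\<close>

lemma jointly_hyponormal_Theta_iff:
  assumes "\<And>n. 0 < \<omega> n" "bounded (range \<omega>)"
  shows "jointly_hyponormal (Theta \<omega>) \<longleftrightarrow> incseq \<omega>"
proof -
  let ?S = "wshift right (lev \<omega>)" and ?T = "wshift up (lev \<omega>)"
  note b = bounded_lev[OF assms(2)]
  note coord = wshift_coord[OF inj_right b] wshift_coord[OF inj_up b]
  note cad = cadjoint_wshift_coord[OF inj_right b] cadjoint_wshift_coord[OF inj_up b]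
  have "incseq \<omega> \<longleftrightarrow> (\<forall>x y. norm (cadjoint ?S x + cadjoint ?T y) \<le> norm (?T x + ?S y))"
  proof (intro iffI allI)
    fix x y assume inc: "incseq \<omega>"
    let ?u = "?T x + ?S y" and ?v = "cadjoint ?S x + cadjoint ?T y"
    \<comment> \<open>The diagonal translation matches each coordinate of \<open>?v\<close> with the
      coordinate of \<open>?u\<close> built from the same entries of \<open>x\<close> and
      \<open>y\<close>.\<close>
    let ?\<sigma> = "\<lambda>k. right (up k)"
    have inj: "inj ?\<sigma>" by (auto simp: inj_def)
    have sum: "(\<lambda>k. (cmod (ell2_coord ?u (?\<sigma> k)))\<^sup>2) summable_on UNIV"
      using summable_on_subset_banach[OF summable_coord, of "range ?\<sigma>" ?u]
        summable_on_reindex[OF inj, of "\<lambda>i. (cmod (ell2_coord ?u i))\<^sup>2"] by (simp add: o_def)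
    have "(norm ?v)\<^sup>2 \<le> (\<Sum>\<^sub>\<infinity>k. (cmod (ell2_coord ?u (?\<sigma> k)))\<^sup>2)"
      unfolding norm_ell2_sq
    proof (intro infsum_mono summable_coord sum power_mono norm_ge_zero)
      fix k :: "nat \<times> nat"
      obtain i j where k: "k = (i, j)" by (cases k)
      let ?z = "ell2_coord x (i + 1, j) + ell2_coord y (i, j + 1)"
      have "ell2_coord ?u (?\<sigma> k) = \<omega> (Suc (i + j)) * ?z"
        using coord(2)[of x "(i + 1, j)"] coord(1)[of y "(i, j + 1)"]
        by (simp add: k plus_ell2.rep_eq distrib_left)
      moreover have "ell2_coord ?v k = \<omega> (i + j) * ?z"
        by (simp add: k plus_ell2.rep_eq cad distrib_left)
      ultimately show "cmod (ell2_coord ?v k) \<le> cmod (ell2_coord ?u (?\<sigma> k))"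
        using incseq_SucD[OF inc, of "i + j"] assms(1)[of "i + j"]
        by (simp add: norm_mult mult_right_mono del: of_real_add)
    qed
    also have "\<dots> = (\<Sum>\<^sub>\<infinity>k\<in>range ?\<sigma>. (cmod (ell2_coord ?u k))\<^sup>2)"
      using infsum_reindex[OF inj, of "\<lambda>i. (cmod (ell2_coord ?u i))\<^sup>2"] by (simp add: o_def)
    \<comment> \<open>The coordinates of \<open>?u\<close> on the two axes lie outside
      \<open>range ?\<sigma>\<close> and only enlarge the right-hand side.\<close>
    also have "\<dots> \<le> (norm ?u)\<^sup>2"
      unfolding norm_ell2_sq
      by (rule infsum_mono_neutral)
        (auto intro: summable_coord summable_on_subset_banach[OF summable_coord])
    finally show "norm ?v \<le> norm ?u" by (rule power2_le_imp_le) simp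
  next
    assume H: "\<forall>x y. norm (cadjoint ?S x + cadjoint ?T y) \<le> norm (?T x + ?S y)"
    show "incseq \<omega>"
    proof (rule incseq_SucI)
      fix n
      \<comment> \<open>With \<open>x = ket (n + 1, 0)\<close> and \<open>y = 0\<close> the adjoint
        steps back to level \<open>n\<close>, whereas \<open>?T\<close> uses the weight at level
        \<open>n + 1\<close>; the two norms are exactly the weights to be compared.\<close>
      have "cadjoint ?S (ket (n + 1, 0)) = complex_of_real (\<omega> n) *\<^sub>C ket (n, 0)"
        by (rule ell2_eqI) (auto simp: cad scaleC.rep_eq ket.rep_eq)
      moreover have "cadjoint ?T 0 = 0" "?S 0 = 0"
        by (auto intro!: ell2_eqI simp: cad zero_ell2.rep_eq
            bounded_clinear_zero bounded_clinear_wshift[OF inj_right b])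
      moreover have "?T (ket (n + 1, 0)) = complex_of_real (\<omega> (Suc n)) *\<^sub>C ket (n + 1, 1)"
        by (simp add: wshift_ket[OF inj_up b])
      ultimately show "\<omega> n \<le> \<omega> (Suc n)"
        using H[rule_format, of "ket (n + 1, 0)" 0] assms(1)[of n] assms(1)[of "Suc n"]
        by (simp add: norm_scaleC)
    qed
  qed
  then show ?thesis
    using jointly_hyponormal_Theta_norm[OF assms(2) Theta_wshift] by blast
qed

theorem theorem2p4:
  fixes \<omega> :: "nat \<Rightarrow> real"
  assumes "\<And>n. \<omega> n > 0"
    and "bounded (range \<omega>)"
    and "jointly_hyponormal (Theta \<omega>)"
  shows "jointly_hyponormal (toral_aluthge (Theta \<omega>)) \<and>
         jointly_hyponormal (spherical_aluthge (Theta \<omega>))"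
proof -
  let ?v = "\<lambda>n. sqrt (\<omega> n * \<omega> (Suc n))"
  have inc: "incseq \<omega>" using jointly_hyponormal_Theta_iff[OF assms(1,2)] assms(3) by blast
  \<comment> \<open>Passing from \<open>n\<close> to \<open>n + 1\<close> enlarges both positive
    factors under the root. The characterisation is then used in its other direction, for
    \<open>?v\<close>.\<close>
  have "incseq ?v"
    using incseq_SucD[OF inc] less_imp_le[OF assms(1)]
    by (intro incseq_SucI) (auto intro!: mult_mono)
  moreover have "bounded (range (\<lambda>n. \<omega> n * \<omega> (Suc n)))"
    by (intro bounded_range_mult assms(2) bounded_subset[OF assms(2)]) auto
  then have "bounded (range ?v)"
    using assms(1) by (intro bounded_range_sqrt) auto
  moreover have "0 < ?v n" for n using assms(1) by simp
  ultimately have "jointly_hyponormal (Theta ?v)"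
    using jointly_hyponormal_Theta_iff[of ?v] by blast
  then show ?thesis
    using toral_aluthge_Theta[OF assms(1,2)] spherical_aluthge_Theta[OF assms(1,2)] by simp
qed

end
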